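(* A finite word $w$ is privileged if and only if it has property P.
   Context: $|x|_u$ denotes the number of (possibly overlapping) occurrences of $u$ as a factor of $x$. A nonempty word $u$ is a border of $x$ if $u$ is both a prefix and a suffix of $x$. A word $x$ is privileged (recursive definition) if $|x|\le 1$, or $x$ has a border $u$ with $|x|_u=2$ that is itself privileged. A word $w$ has property P if for all $n$ with $1\le n\le |w|$ there exists a word $x$ with $1\le |x|\le n$ such that $x$ occurs exactly once in the first $n$ symbols of $w$, as a prefix, and $x$ also occurs exactly once in the last $n$ symbols of $w$, as a suffix. *)

theory Defs
  imports "HOL-Library.Sublist"
begin

text \<open>Words over an alphabet are lists; the alphabet is an arbitrary type. The number of
  occurrences \<open>|x|\<^sub>u\<close> is the number of starting positions, so overlapping occurrences
  are counted separately.\<close>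

definition occ_count :: "'a list \<Rightarrow> 'a list \<Rightarrow> nat" where
  "occ_count x u = card {i. i + length u \<le> length x \<and> take (length u) (drop i x) = u}"

definition border :: "'a list \<Rightarrow> 'a list \<Rightarrow> bool" where
  "border u x \<longleftrightarrow> u \<noteq> [] \<and> prefix u x \<and> suffix u x"

text \<open>The definition of a border admits \<open>u = x\<close>, but \<open>occ_count x u = 2\<close> excludes it, so
  the recursion is on strictly shorter words.\<close>

inductive privileged :: "'a list \<Rightarrow> bool" where
  short: "length x \<le> 1 \<Longrightarrow> privileged x"
| step: "border u x \<Longrightarrow> occ_count x u = 2 \<Longrightarrow> privileged u \<Longrightarrow> privileged x"

definition property_P :: "'a list \<Rightarrow> bool" where
  "property_P w \<longleftrightarrow>
     (\<forall>n. 1 \<le> n \<and> n \<le> length w \<longrightarrow>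
       (\<exists>x. 1 \<le> length x \<and> length x \<le> n \<and>
            prefix x (take n w) \<and> occ_count (take n w) x = 1 \<and>
            suffix x (drop (length w - n) w) \<and> occ_count (drop (length w - n) w) x = 1))"

end

theory Submission
  imports Defs
begin

text \<open>Property P at length \<open>n\<close> depends only on the first and last \<open>n\<close> letters, so it passes between
  a word and its borders as long as \<open>n\<close> does not exceed the length of the border. A border \<open>u\<close> with
  exactly two occurrences in \<open>w\<close> is a witness for all \<open>n\<close> with \<open>|u| \<le> n < |w|\<close>, and \<open>w\<close> itself is
  one for \<open>n = |w|\<close>. Conversely, any witness for \<open>n = |w| - 1\<close> is a border occurring exactly twice.\<close>

text \<open>The set of positions behind \<open>occ_count\<close>: unlike its cardinality, it can be
  compared between a word and its prefixes and suffixes.\<close>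

definition occs :: "'a list \<Rightarrow> 'a list \<Rightarrow> nat set" where
  "occs x u = {i. i + length u \<le> length x \<and> take (length u) (drop i x) = u}"

lemma occ_count_occs: "occ_count x u = card (occs x u)"
  by (simp add: occ_count_def occs_def)

lemma finite_occs [simp]: "finite (occs x u)"
  by (rule finite_subset[of _ "{..length x}"]) (auto simp: occs_def)

lemma occs_take:
  assumes "n \<le> length x"
  shows "occs (take n x) u = {i \<in> occs x u. i + length u \<le> n}"
  using assms by (auto simp: occs_def drop_take min_def)

lemma mem_occs_drop:
  assumes "k \<le> length x"
  shows "i \<in> occs (drop k x) u \<longleftrightarrow> i + k \<in> occs x u"
  using assms by (auto simp: occs_def)

lemma prefix_0_occs: "prefix u x \<Longrightarrow> 0 \<in> occs x u"
  by (auto simp: occs_def prefix_def)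

lemma suffix_last_occs: "suffix u x \<Longrightarrow> length x - length u \<in> occs x u"
  by (auto simp: occs_def suffix_def)

lemma occs_self: "occs x x = {0}"
  by (auto simp: occs_def)

lemma occs_le: "i \<in> occs x u \<Longrightarrow> i \<le> length x - length u"
  by (auto simp: occs_def)

text \<open>A border always occurs at 0 and at \<open>length w - length u\<close>. These positions
  differ exactly when the border is proper, and a two-element subset of a two-element set is the
  whole set.\<close>

lemma border_occs_iff:
  assumes "border u w"
  shows "occ_count w u = 2 \<longleftrightarrow>
    length u < length w \<and> occs w u = {0, length w - length u}"
proof -
  have sub: "{0, length w - length u} \<subseteq> occs w u" and le: "length u \<le> length w"
    using assms prefix_0_occs suffix_last_occs prefix_length_le
    unfolding border_def by blast+
  show ?thesis
  proof (cases "length u = length w")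
    case True
    with assms have "u = w"
      by (auto simp: border_def prefix_def)
    then show ?thesis
      by (simp add: occ_count_occs occs_self)
  next
    case False
    with le have "length u < length w" by simp
    then have card: "card {0, length w - length u} = 2" by simp
    have "card (occs w u) = 2 \<longleftrightarrow> occs w u = {0, length w - length u}"
      using card card_subset_eq[OF finite_occs sub] by metis
    then show ?thesis
      using \<open>length u < length w\<close> by (simp add: occ_count_occs)
  qed
qed

text \<open>Position 0 is always an occurrence here, so a count of 1 excludes every other position.
  The condition is phrased in positions of \<open>w\<close>, to be matched with
  \<open>occs w u\<close>.\<close>

lemma occ_count_take_prefix:
  assumes "prefix u (take n w)" "n \<le> length w"
  shows "occ_count (take n w) u = 1 \<longleftrightarrow> (\<forall>i\<in>occs w u. i + length u \<le> n \<longrightarrow> i = 0)"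
proof -
  have "0 \<in> occs (take n w) u"
    using assms by (simp add: prefix_0_occs)
  then have "occ_count (take n w) u = 1 \<longleftrightarrow> (\<forall>i\<in>occs (take n w) u. i = 0)"
    unfolding occ_count_occs card_1_singleton_iff One_nat_def by auto
  then show ?thesis
    by (auto simp: occs_take[OF assms(2)])
qed

lemma occ_count_drop_suffix:
  assumes "suffix u (drop k w)" "k \<le> length w"
  shows "occ_count (drop k w) u = 1 \<longleftrightarrow> (\<forall>i\<in>occs w u. k \<le> i \<longrightarrow> i = length w - length u)"
proof -
  \<comment> \<open>This bound keeps the truncated subtraction
    \<open>length w - k - length u\<close> exact, so that shifting by \<open>k\<close> gives
    \<open>length w - length u\<close>.\<close>
  have len: "length u \<le> length w - k"
    using suffix_length_le[OF assms(1)] by simp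
  have last: "length w - k - length u \<in> occs (drop k w) u"
    using suffix_last_occs[OF assms(1)] by simp
  have "occ_count (drop k w) u = 1 \<longleftrightarrow> (\<forall>j\<in>occs (drop k w) u. j = length w - k - length u)"
    unfolding occ_count_occs card_1_singleton_iff One_nat_def using last by auto
  also have "\<dots> \<longleftrightarrow> (\<forall>i\<in>occs w u. k \<le> i \<longrightarrow> i = length w - length u)"
  proof
    assume L: "\<forall>j\<in>occs (drop k w) u. j = length w - k - length u"
    show "\<forall>i\<in>occs w u. k \<le> i \<longrightarrow> i = length w - length u"
    proof (intro ballI impI)
      fix i assume "i \<in> occs w u" "k \<le> i"
      then have "i - k \<in> occs (drop k w) u"
        by (simp add: mem_occs_drop assms(2))
      with L have "i - k = length w - k - length u" by blast
      then show "i = length w - length u"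
        using \<open>k \<le> i\<close> len assms(2) by linarith
    qed
  next
    assume "\<forall>i\<in>occs w u. k \<le> i \<longrightarrow> i = length w - length u"
    then show "\<forall>j\<in>occs (drop k w) u. j = length w - k - length u"
      using mem_occs_drop[OF assms(2)] by fastforce
  qed
  finally show ?thesis .
qed

text \<open>Property P at one fixed \<open>n\<close>, isolated because different ranges of
  \<open>n\<close> call for different witnesses.\<close>

definition P_at :: "'a list \<Rightarrow> nat \<Rightarrow> bool" where
  "P_at w n \<longleftrightarrow> (\<exists>x. 1 \<le> length x \<and> length x \<le> n \<and>
     prefix x (take n w) \<and> occ_count (take n w) x = 1 \<and>
     suffix x (drop (length w - n) w) \<and> occ_count (drop (length w - n) w) x = 1)"

lemma property_P_iff: "property_P w \<longleftrightarrow> (\<forall>n. 1 \<le> n \<and> n \<le> length w \<longrightarrow> P_at w n)"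
  by (simp add: property_P_def P_at_def)

lemma P_at_border:
  assumes "border u w" "n \<le> length u"
  shows "P_at u n \<longleftrightarrow> P_at w n"
proof -
  have "take n w = take n u"
    using assms by (auto simp: border_def prefix_def)
  moreover have "drop (length w - n) w = drop (length u - n) u"
    using assms by (auto simp: border_def suffix_def)
  ultimately show ?thesis
    by (simp add: P_at_def)
qed

lemma P_at_length: "w \<noteq> [] \<Longrightarrow> P_at w (length w)"
  unfolding P_at_def by (rule exI[of _ w]) (simp add: occ_count_occs occs_self Suc_le_eq)

text \<open>The witness is \<open>u\<close>: since \<open>n < length w\<close>, the first
  \<open>n\<close> letters miss the end of the final occurrence and the last \<open>n\<close>
  letters miss the start of the initial one.\<close>

lemma P_at_border_between:
  assumes "border u w" "occ_count w u = 2" "length u \<le> n" "n < length w"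
  shows "P_at w n"
proof -
  have occ: "occs w u = {0, length w - length u}"
    using assms border_occs_iff by blast
  have pre: "prefix u (take n w)"
    using assms by (auto simp: border_def prefix_def)
  have suf: "suffix u (drop (length w - n) w)"
    using assms by (auto simp: border_def suffix_def)
  have "occ_count (take n w) u = 1"
    using occ_count_take_prefix[OF pre] occ assms by auto
  moreover have "occ_count (drop (length w - n) w) u = 1"
    using occ_count_drop_suffix[OF suf] occ assms by auto
  moreover have "1 \<le> length u"
    using assms by (simp add: border_def Suc_le_eq)
  ultimately show ?thesis
    using pre suf assms unfolding P_at_def by blast
qed

lemma privileged_imp_property_P: "privileged w \<Longrightarrow> property_P w"
proof (induction rule: privileged.induct)
  case (short w)
  then show ?case
    unfolding property_P_iff
    \<comment> \<open>Only \<open>n = length w = 1\<close> can arise.\<close>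
    by (metis P_at_length le_antisym le_trans list.size(3) not_one_le_zero)
next
  case (step u w)
  show ?case
    unfolding property_P_iff
  proof (intro allI impI)
    fix n assume n: "1 \<le> n \<and> n \<le> length w"
    \<comment> \<open>The witness comes, in turn, from the induction hypothesis for
      \<open>u\<close>, from \<open>u\<close> itself, and from \<open>w\<close> itself.\<close>
    consider "n \<le> length u" | "length u \<le> n" "n < length w" | "n = length w"
      using n by linarith
    then show "P_at w n"
    proof cases
      case 1
      then show ?thesis
        using step n P_at_border property_P_iff by blast
    next
      case 2
      then show ?thesis
        using step P_at_border_between by blast
    next
      case 3
      then show ?thesis
        using n P_at_length[of w] by fastforce
    qed
  qed
qed

lemma P_at_pred_length_imp_border:
  assumes "P_at w (length w - 1)"
  obtains u where "border u w" "occ_count w u = 2" "length u < length w"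
proof -
  let ?n = "length w - 1"
  obtain u where u: "1 \<le> length u" "length u \<le> ?n"
    and pre: "prefix u (take ?n w)" and pre1: "occ_count (take ?n w) u = 1"
    and suf: "suffix u (drop (length w - ?n) w)"
    and suf1: "occ_count (drop (length w - ?n) w) u = 1"
    using assms unfolding P_at_def by blast
  have border: "border u w"
    unfolding border_def
    using u(1) pre suf take_is_prefix prefix_order.trans suffix_drop suffix_order.trans
    by fastforce
  \<comment> \<open>As \<open>u\<close> is nonempty, \<open>?n\<close> is at least 1, so its
    subtraction is not truncated.\<close>
  have len: "length u < length w"
    using u by linarith
  have "i = 0 \<or> i = length w - length u" if "i \<in> occs w u" for i
  proof (cases "i + length u \<le> ?n")
    case True
    then show ?thesis
      using that pre1 occ_count_take_prefix[OF pre] by simp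
  next
    \<comment> \<open>An occurrence not contained in the first \<open>length w - 1\<close> letters
      must end at the last letter of \<open>w\<close>.\<close>
    case False
    with occs_le[OF that] len show ?thesis by linarith
  qed
  moreover have "0 \<in> occs w u" "length w - length u \<in> occs w u"
    using border prefix_0_occs suffix_last_occs unfolding border_def by auto
  ultimately have "occs w u = {0, length w - length u}"
    by blast
  then show thesis
    using that border len border_occs_iff by blast
qed

lemma property_P_imp_privileged: "property_P w \<Longrightarrow> privileged w"
proof (induction w rule: length_induct)
  case (1 w)
  show ?case
  proof (cases "length w \<le> 1")
    case True
    then show ?thesis by (rule privileged.short)
  next
    case False
    \<comment> \<open>Here \<open>length w\<close> is at least 2, so \<open>length w - 1\<close> is
      an admissible value of \<open>n\<close>.\<close>
    then have "P_at w (length w - 1)"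
      using 1(2) by (simp add: property_P_iff)
    then obtain u where u: "border u w" "occ_count w u = 2" "length u < length w"
      by (rule P_at_pred_length_imp_border)
    \<comment> \<open>Each \<open>n \<le> length u\<close> is also admissible for \<open>w\<close>,
      and \<open>P_at\<close> passes from \<open>w\<close> down to its border.\<close>
    have "property_P u"
      using 1(2) u P_at_border[OF u(1)] by (simp add: property_P_iff)
    then show ?thesis
      using 1(1) u privileged.step by blast
  qed
qed

theorem theorem8:
  fixes w :: "'a list"
  shows "privileged w \<longleftrightarrow> property_P w"
  using privileged_imp_property_P property_P_imp_privileged by blast

end
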